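(* Let $M\ge D\ge 1$ be integers and let $\mathbf{S}_{GEB}\in\mathbb{C}^{M\times D}$ satisfy $\mathbf{S}_{GEB}^H\mathbf{S}_{GEB}=\mathbf{I}_D$. Consider Algorithms 1, 2 and 3 described in the context, run without stopping, from any admissible initialization (for Algorithm 2, with any given connection matrix $\mathbf{\Pi}$). Then for each of the three algorithms the sequence of cost function values is monotonically non-increasing at each iteration and bounded below, and hence convergent. Explicitly, each of the following sequences, indexed by $n=0,1,2,\dots$, is non-increasing, bounded below, and convergent: (1) for Algorithm 1: $\|\mathbf{S}_{GEB}\mathbf{S}_{cm,n}^H-\mathbf{S}_{c,n+1}\|_F$; (2) for Algorithm 2: $\|\mathbf{S}_{GEB}-\mathbf{S}_{c,n+1}\mathbf{S}_{cm,n}\|_F$; (3) for Algorithm 3: $\|\mathbf{S}_{GEB}\mathbf{A}_n-\tilde{\mathbf{S}}_{c,n+1}\|_F$.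
   Context: $\mathbf{X}^H$ is the conjugate transpose, $\|\cdot\|_F$ the Frobenius norm, $[\mathbf{X}]_{(i,j)}$ the $(i,j)$ entry, $[\mathbf{X}]_{(i,:)}$ the $i$-th row (a row vector), and $[\mathbf{X}]_{(i,:)}^H$ its conjugate transpose. For a complex number $z$, $\measuredangle(z)$ denotes its phase (argument), with any fixed choice of value when $z=0$. For a matrix $\mathbf{X}$, $e^{j\measuredangle(\mathbf{X})}$ is the matrix obtained entrywise, where in the exponent $j=\sqrt{-1}$. In each SVD below, $\mathbf{U}_n,\mathbf{V}_n$ are $D\times D$ unitary matrices and $\boldsymbol{\Sigma}_n$ is diagonal with non-negative entries; any SVD may be chosen. Algorithm 1 (PE-AM, fully connected array). Initialize $\mathbf{S}_{c,0}=\frac{1}{\sqrt M}e^{j\measuredangle(\mathbf{S}_{GEB})}$. For $n=0,1,2,\dots$: take an SVD $\mathbf{S}_{GEB}^H\mathbf{S}_{c,n}=\mathbf{U}_n\boldsymbol{\Sigma}_n\mathbf{V}_n^H$; set $\mathbf{S}_{cm,n}=\mathbf{V}_n\mathbf{U}_n^H$; set $\mathbf{S}_{c,n+1}=\frac{1}{\sqrt M}e^{j\measuredangle(\mathbf{S}_{GEB}\mathbf{S}_{cm,n}^H)}$. Algorithm 2 (fixed subarray). Input also a binary connection matrix $\mathbf{\Pi}\in\{0,1\}^{M\times D}$ in which each row $i$ has exactly one non-zero entry, located in column $j(i)$, and each column has at least one non-zero entry. Initialize $\mathbf{S}_{c,0}\in\mathbb{C}^{M\times D}$ with arbitrary phases,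 subject to $|[\mathbf{S}_{c,0}]_{(i,j)}|=\frac{1}{\sqrt M}[\mathbf{\Pi}]_{(i,j)}$ for all $i,j$. For $n=0,1,2,\dots$: set $\mathbf{S}_{cm,n}=(\mathbf{S}_{c,n}^H\mathbf{S}_{c,n})^{-1}\mathbf{S}_{c,n}^H\mathbf{S}_{GEB}$; let $\mathbf{S}_{c,n+1}$ be the matrix whose only non-zero entry in row $i$ is in column $j(i)$ and equals $\frac{1}{\sqrt M}e^{j\beta_i}$ with $\beta_i=\measuredangle\big([\mathbf{S}_{GEB}]_{(i,:)}[\mathbf{S}_{cm,n}]_{(j(i),:)}^H\big)$. Algorithm 3 (dynamic connection). Initialize $\tilde{\mathbf{S}}_{c,0}\in\mathbb{C}^{M\times D}$ with arbitrary phases, subject to each row having exactly one non-zero entry, of modulus $1$. For $n=0,1,2,\dots$: take an SVD $\mathbf{S}_{GEB}^H\tilde{\mathbf{S}}_{c,n}=\mathbf{U}_n\boldsymbol{\Sigma}_n\mathbf{V}_n^H$; set $\mathbf{A}_n=\mathbf{U}_n\mathbf{V}_n^H$ (a minimizer of $\|\mathbf{S}_{GEB}\mathbf{A}-\tilde{\mathbf{S}}_{c,n}\|_F$ over unitary $\mathbf{A}$); let $j^\star(i)\in\arg\max_{1\le j\le D}|[\mathbf{S}_{GEB}\mathbf{A}_n]_{(i,j)}|$ (ties broken arbitrarily), and let $\tilde{\mathbf{S}}_{c,n+1}$ be the matrix whose only non-zero entry in row $i$ is in column $j^\star(i)$ and equals $e^{j\measuredangle([\mathbf{S}_{GEB}\mathbf{A}_n]_{(i,j^\star(i))})}$.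 *)

theory Defs
  imports "HOL-Analysis.Analysis"
begin

definition conj_transpose :: "complex^'n^'m \<Rightarrow> complex^'m^'n"
  where "conj_transpose X = (\<chi> i k. cnj (X $ k $ i))"

definition unitary_matrix :: "complex^'n^'n \<Rightarrow> bool"
  where "unitary_matrix U \<longleftrightarrow>
    conj_transpose U ** U = mat 1 \<and> U ** conj_transpose U = mat 1"

definition is_svd :: "complex^'n^'n \<Rightarrow> complex^'n^'n \<Rightarrow> complex^'n^'n \<Rightarrow> complex^'n^'n \<Rightarrow> bool"
  where "is_svd X U \<Sigma> V \<longleftrightarrow>
    unitary_matrix U \<and> unitary_matrix V \<and>
    (\<forall>i k. i \<noteq> k \<longrightarrow> \<Sigma> $ i $ k = 0) \<and> (\<forall>i. \<Sigma> $ i $ i \<in> \<real>\<^sub>\<ge>\<^sub>0) \<and>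
    X = U ** \<Sigma> ** conj_transpose V"

text \<open>The norm of type \<open>complex^'n^'m\<close> is the Frobenius norm.\<close>

lemma norm_matrix_eq_frobenius:
  fixes X :: "complex^'n^'m"
  shows "norm X = sqrt (\<Sum>i\<in>UNIV. \<Sum>k\<in>UNIV. (cmod (X $ i $ k))\<^sup>2)"
  by (simp add: norm_vec_def L2_set_def sum_nonneg)

text \<open>The phase of \<open>0\<close> is an arbitrary fixed value \<open>\<theta>\<close>.\<close>

definition phase :: "real \<Rightarrow> complex \<Rightarrow> real"
  where "phase \<theta> z = (if z = 0 then \<theta> else Arg z)"

definition exp_phase :: "real \<Rightarrow> complex^'n^'m \<Rightarrow> complex^'n^'m"
  where "exp_phase \<theta> X = (\<chi> i k. cis (phase \<theta> (X $ i $ k)))"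

text \<open>In the runs below \<open>M = CARD('m)\<close> and \<open>D = CARD('d)\<close>, and \<open>S\<close> is the matrix
  \<open>S_GEB\<close>. Each run is a predicate on whole sequences of iterates, so that every
  admissible initialization, SVD and tie-breaking is allowed.\<close>

text \<open>PE-AM for the fully connected array.\<close>

definition full_run ::
    "real \<Rightarrow> complex^'d^'m \<Rightarrow> (nat \<Rightarrow> complex^'d^'m) \<Rightarrow> (nat \<Rightarrow> complex^'d^'d) \<Rightarrow> bool"
  where "full_run \<theta> S Sc Scm \<longleftrightarrow>
    Sc 0 = (1 / sqrt (real CARD('m))) *\<^sub>R exp_phase \<theta> S \<and>
    (\<forall>n. (\<exists>U \<Sigma> V. is_svd (conj_transpose S ** Sc n) U \<Sigma> V \<and>
                  Scm n = V ** conj_transpose U) \<and>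
         Sc (Suc n) = (1 / sqrt (real CARD('m))) *\<^sub>R exp_phase \<theta> (S ** conj_transpose (Scm n)))"

definition full_cost ::
    "complex^'d^'m \<Rightarrow> (nat \<Rightarrow> complex^'d^'m) \<Rightarrow> (nat \<Rightarrow> complex^'d^'d) \<Rightarrow> nat \<Rightarrow> real"
  where "full_cost S Sc Scm n = norm (S ** conj_transpose (Scm n) - Sc (Suc n))"

text \<open>Fixed subarray.\<close>

definition connection_matrix :: "real^'d^'m \<Rightarrow> bool"
  where "connection_matrix P \<longleftrightarrow>
    (\<forall>i k. P $ i $ k \<in> {0, 1}) \<and> (\<forall>i. \<exists>!k. P $ i $ k \<noteq> 0) \<and> (\<forall>k. \<exists>i. P $ i $ k \<noteq> 0)"

definition conn_col :: "real^'d^'m \<Rightarrow> 'm \<Rightarrow> 'd"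
  where "conn_col P i = (THE k. P $ i $ k \<noteq> 0)"

definition fixed_run ::
    "real \<Rightarrow> complex^'d^'m \<Rightarrow> real^'d^'m \<Rightarrow> (nat \<Rightarrow> complex^'d^'m) \<Rightarrow> (nat \<Rightarrow> complex^'d^'d) \<Rightarrow> bool"
  where "fixed_run \<theta> S P Sc Scm \<longleftrightarrow>
    (\<forall>i k. cmod (Sc 0 $ i $ k) = 1 / sqrt (real CARD('m)) * P $ i $ k) \<and>
    (\<forall>n. Scm n = matrix_inv (conj_transpose (Sc n) ** Sc n) ** conj_transpose (Sc n) ** S \<and>
         Sc (Suc n) = (\<chi> i k. if k = conn_col P i
            then complex_of_real (1 / sqrt (real CARD('m))) *
                 cis (phase \<theta> (\<Sum>l\<in>UNIV. S $ i $ l * cnj (Scm n $ conn_col P i $ l)))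
            else 0))"

definition fixed_cost ::
    "complex^'d^'m \<Rightarrow> (nat \<Rightarrow> complex^'d^'m) \<Rightarrow> (nat \<Rightarrow> complex^'d^'d) \<Rightarrow> nat \<Rightarrow> real"
  where "fixed_cost S Sc Scm n = norm (S - Sc (Suc n) ** Scm n)"

text \<open>Dynamic connection; \<open>St\<close> is the sequence of unit-modulus matrices written with a
  tilde.\<close>

definition dynamic_run ::
    "real \<Rightarrow> complex^'d^'m \<Rightarrow> (nat \<Rightarrow> complex^'d^'m) \<Rightarrow> (nat \<Rightarrow> complex^'d^'d) \<Rightarrow> bool"
  where "dynamic_run \<theta> S St A \<longleftrightarrow>
    (\<forall>i. (\<exists>!k. St 0 $ i $ k \<noteq> 0) \<and> (\<forall>k. St 0 $ i $ k \<noteq> 0 \<longrightarrow> cmod (St 0 $ i $ k) = 1)) \<and>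
    (\<forall>n. (\<exists>U \<Sigma> V. is_svd (conj_transpose S ** St n) U \<Sigma> V \<and>
                  A n = U ** conj_transpose V) \<and>
         (\<exists>js :: 'm \<Rightarrow> 'd.
            (\<forall>i. is_arg_max (\<lambda>k. cmod ((S ** A n) $ i $ k)) (\<lambda>_. True) (js i)) \<and>
            St (Suc n) = (\<chi> i k. if k = js i
              then cis (phase \<theta> ((S ** A n) $ i $ js i)) else 0)))"

definition dynamic_cost ::
    "complex^'d^'m \<Rightarrow> (nat \<Rightarrow> complex^'d^'m) \<Rightarrow> (nat \<Rightarrow> complex^'d^'d) \<Rightarrow> nat \<Rightarrow> real"
  where "dynamic_cost S St A n = norm (S ** A n - St (Suc n))"

end

theory Submission
  imports Defs
begin

text \<open>With the real inner product \<open>A \<bullet> B = Re tr (A\<^sup>H B)\<close>, whose norm is the Frobenius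
  norm, each half-step of each algorithm minimises the cost in one of the two variables: the
  orthogonal Procrustes problem (SVD steps), least squares (the pseudo-inverse step), and a
  maximisation of \<open>Re (z * cnj w)\<close> over \<open>w\<close> of fixed modulus (phase steps). Alternating
  minimisation never increases the cost.\<close>

section \<open>Conjugate transposes and the real trace inner product\<close>

lemma conj_transpose_nth [simp]: "conj_transpose X $ i $ k = cnj (X $ k $ i)"
  by (simp add: conj_transpose_def)

lemma conj_transpose_conj_transpose [simp]: "conj_transpose (conj_transpose X) = X"
  by (simp add: vec_eq_iff)

lemma conj_transpose_matrix_mult:
  "conj_transpose (X ** Y) = conj_transpose Y ** conj_transpose X"
  by (simp add: vec_eq_iff matrix_matrix_mult_def mult.commute)

lemma matrix_mult_nth: "(X ** Y) $ i $ k = (\<Sum>l\<in>UNIV. X $ i $ l * Y $ l $ k)"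
  by (simp add: matrix_matrix_mult_def)

lemma matrix_mult_diff_right:
  fixes A :: "complex^'n^'m"
  shows "A ** (B - C) = A ** B - A ** C"
  by (simp add: vec_eq_iff matrix_mult_nth right_diff_distrib sum_subtractf)

lemma matrix_mult_matrix_inv:
  "invertible A \<Longrightarrow> A ** matrix_inv A = mat 1"
  unfolding invertible_def matrix_inv_def by (rule someI2_ex) auto

text \<open>Left multiplication by \<open>X\<close> has \<open>conj_transpose X\<close> as its
  adjoint: both sides are the same triple sum, taken in different orders.\<close>

lemma inner_matrix_mult_left:
  fixes X :: "complex^'n^'m" and Y :: "complex^'k^'n"
  shows "(X ** Y) \<bullet> Z = Y \<bullet> (conj_transpose X ** Z)"
proof -
  have "(X ** Y) \<bullet> Z = (\<Sum>i\<in>UNIV. \<Sum>k\<in>UNIV. \<Sum>l\<in>UNIV. Re (X $ i $ l * Y $ l $ k * cnj (Z $ i $ k)))"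
    by (simp add: inner_vec_def matrix_mult_nth inner_sum_left)
      (simp add: inner_complex_def algebra_simps)
  also have "\<dots> = (\<Sum>i\<in>UNIV. \<Sum>l\<in>UNIV. \<Sum>k\<in>UNIV. Re (X $ i $ l * Y $ l $ k * cnj (Z $ i $ k)))"
    by (intro sum.cong refl sum.swap)
  also have "\<dots> = (\<Sum>l\<in>UNIV. \<Sum>i\<in>UNIV. \<Sum>k\<in>UNIV. Re (X $ i $ l * Y $ l $ k * cnj (Z $ i $ k)))"
    by (rule sum.swap)
  also have "\<dots> = (\<Sum>l\<in>UNIV. \<Sum>k\<in>UNIV. \<Sum>i\<in>UNIV. Re (X $ i $ l * Y $ l $ k * cnj (Z $ i $ k)))"
    by (intro sum.cong refl sum.swap)
  also have "\<dots> = Y \<bullet> (conj_transpose X ** Z)"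
    unfolding inner_vec_def
  proof (intro sum.cong refl)
    fix l k
    have "Re (x * y * cnj z) = y \<bullet> (cnj x * z)" for x y z
      by (simp add: inner_complex_def algebra_simps)
    then show "(\<Sum>i\<in>UNIV. Re (X $ i $ l * Y $ l $ k * cnj (Z $ i $ k)))
        = Y $ l $ k \<bullet> (conj_transpose X ** Z) $ l $ k"
      by (simp only: matrix_mult_nth inner_sum_right conj_transpose_nth)
  qed
  finally show ?thesis .
qed

lemma inner_conj_transpose:
  fixes X Y :: "complex^'n^'m"
  shows "conj_transpose X \<bullet> conj_transpose Y = X \<bullet> Y"
  unfolding inner_vec_def by (subst sum.swap) (simp add: inner_complex_def)

text \<open>Conjugate transposition preserves the inner product and reverses products, so this is
  the left-hand version transposed.\<close>

lemma inner_matrix_mult_right: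
  fixes X :: "complex^'n^'m" and Y :: "complex^'k^'n"
  shows "(X ** Y) \<bullet> Z = X \<bullet> (Z ** conj_transpose Y)"
proof -
  have "(X ** Y) \<bullet> Z = (conj_transpose Y ** conj_transpose X) \<bullet> conj_transpose Z"
    by (simp flip: conj_transpose_matrix_mult add: inner_conj_transpose)
  also have "\<dots> = conj_transpose X \<bullet> conj_transpose (Z ** conj_transpose Y)"
    by (simp add: inner_matrix_mult_left conj_transpose_matrix_mult)
  finally show ?thesis
    by (simp add: inner_conj_transpose)
qed

text \<open>After squaring and expanding, all terms but the cross terms cancel. Nearest-point
  problems among vectors of equal norm thus become maximisations of a linear functional.\<close>

lemma norm_diff_le_iff_inner:
  fixes x y z :: "'a::real_inner"
  assumes "x \<bullet> x = y \<bullet> y"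
  shows "norm (z - x) \<le> norm (z - y) \<longleftrightarrow> z \<bullet> y \<le> z \<bullet> x"
  using assms by (auto simp: norm_le inner_diff inner_commute)

section \<open>Unitary matrices, the Procrustes problem and least squares\<close>

lemma unitary_matrix_mult:
  assumes "unitary_matrix U" "unitary_matrix V"
  shows "unitary_matrix (U ** V)"
  using assms unfolding unitary_matrix_def conj_transpose_matrix_mult
  by (metis matrix_mul_assoc matrix_mul_lid)

lemma unitary_matrix_conj_transpose:
  "unitary_matrix U \<Longrightarrow> unitary_matrix (conj_transpose U)"
  by (simp add: unitary_matrix_def)

text \<open>Each column of a unitary matrix has norm 1, which bounds every entry in it.\<close>

lemma cmod_unitary_matrix_le_1:
  assumes "unitary_matrix W"
  shows "cmod (W $ i $ k) \<le> 1"
proof -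
  have "(\<Sum>l\<in>UNIV. cnj (W $ l $ k) * W $ l $ k) = (conj_transpose W ** W) $ k $ k"
    by (simp add: matrix_mult_nth)
  also have "\<dots> = 1"
    using assms by (simp add: unitary_matrix_def mat_def)
  also have "(\<Sum>l\<in>UNIV. cnj (W $ l $ k) * W $ l $ k) = of_real (\<Sum>l\<in>UNIV. (cmod (W $ l $ k))\<^sup>2)"
    by (simp add: complex_norm_square mult.commute del: of_real_power)
  finally have "(\<Sum>l\<in>UNIV. (cmod (W $ l $ k))\<^sup>2) = 1"
    using of_real_eq_1_iff by blast
  moreover have "(cmod (W $ i $ k))\<^sup>2 \<le> (\<Sum>l\<in>UNIV. (cmod (W $ l $ k))\<^sup>2)"
    by (rule member_le_sum) auto
  ultimately show ?thesis
    by (simp add: power_le_one_iff abs_square_le_1)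
qed

lemma inner_isometry_mult:
  fixes S :: "complex^'d^'m"
  assumes "conj_transpose S ** S = mat 1"
  shows "(S ** A) \<bullet> (S ** B) = A \<bullet> B"
  by (simp add: inner_matrix_mult_left matrix_mul_assoc assms)

text \<open>All unitary matrices of one size have the same norm, as
  \<open>norm_diff_le_iff_inner\<close> requires.\<close>

lemma inner_unitary_matrix:
  fixes A :: "complex^'n^'n"
  assumes "unitary_matrix A"
  shows "A \<bullet> A = mat 1 \<bullet> (mat 1 :: complex^'n^'n)"
  using inner_isometry_mult[of A "mat 1" "mat 1"] assms
  by (simp add: unitary_matrix_def)

text \<open>Only diagonal entries contribute; there a real part of at most 1 multiplies a
  non-negative number.\<close>

lemma inner_unitary_diagonal_le:
  fixes W \<Sigma> :: "complex^'n^'n"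
  assumes W: "unitary_matrix W"
    and off: "\<And>i k. i \<noteq> k \<Longrightarrow> \<Sigma> $ i $ k = 0"
    and diag: "\<And>i. \<Sigma> $ i $ i \<in> \<real>\<^sub>\<ge>\<^sub>0"
  shows "W \<bullet> \<Sigma> \<le> mat 1 \<bullet> \<Sigma>"
  unfolding inner_vec_def
proof (intro sum_mono)
  fix i k
  show "W $ i $ k \<bullet> \<Sigma> $ i $ k \<le> mat 1 $ i $ k \<bullet> \<Sigma> $ i $ k"
  proof (cases "i = k")
    case True
    obtain r where r: "\<Sigma> $ i $ i = of_real r" "r \<ge> 0"
      using diag[of i] by (elim nonneg_Reals_cases)
    have "Re (W $ i $ i) \<le> 1"
      using cmod_unitary_matrix_le_1[OF W, of i i] complex_Re_le_cmod order_trans by blast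
    then have "Re (W $ i $ i) * r \<le> 1 * r"
      using \<open>r \<ge> 0\<close> by (rule mult_right_mono)
    then show ?thesis
      using True r by (simp add: inner_complex_def mat_def)
  qed (simp add: off)
qed

text \<open>Cyclic invariance reduces \<open>A \<bullet> (U \<Sigma> V\<^sup>H)\<close> to \<open>W \<bullet> \<Sigma>\<close> with \<open>W = U\<^sup>H A V\<close> unitary,
  and \<open>W = 1\<close> exactly when \<open>A = U V\<^sup>H\<close>.\<close>
lemma orthogonal_procrustes:
  fixes S X :: "complex^'d^'m"
  assumes S: "conj_transpose S ** S = mat 1"
    and svd: "is_svd (conj_transpose S ** X) U \<Sigma> V"
    and A: "unitary_matrix A"
  shows "norm (S ** (U ** conj_transpose V) - X) \<le> norm (S ** A - X)"
proof -
  have U: "unitary_matrix U" and V: "unitary_matrix V"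
    and eq: "conj_transpose S ** X = U ** \<Sigma> ** conj_transpose V"
    using svd by (auto simp: is_svd_def)
  have red: "X \<bullet> (S ** B) = (conj_transpose U ** B ** V) \<bullet> \<Sigma>" for B
  proof -
    have "X \<bullet> (S ** B) = B \<bullet> (U ** \<Sigma> ** conj_transpose V)"
      by (simp add: inner_commute[of X] inner_matrix_mult_left eq)
    also have "\<dots> = (B ** V) \<bullet> (U ** \<Sigma>)"
      by (simp add: inner_matrix_mult_right)
    also have "\<dots> = (conj_transpose U ** (B ** V)) \<bullet> \<Sigma>"
      by (simp add: inner_matrix_mult_left)
    finally show ?thesis
      by (simp add: matrix_mul_assoc)
  qed
  have "conj_transpose U ** (U ** conj_transpose V) ** V = mat 1"
    using U V by (simp add: unitary_matrix_def matrix_mul_assoc)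
  moreover have "unitary_matrix (conj_transpose U ** A ** V)"
    by (intro unitary_matrix_mult unitary_matrix_conj_transpose U V A)
  ultimately have "X \<bullet> (S ** A) \<le> X \<bullet> (S ** (U ** conj_transpose V))"
    using svd by (simp add: red inner_unitary_diagonal_le is_svd_def)
  \<comment> \<open>With both factors unitary, their images under the isometry \<open>S\<close> have
    equal norms, so the inner-product bound becomes a distance bound.\<close>
  moreover have "unitary_matrix (U ** conj_transpose V)"
    by (intro unitary_matrix_mult unitary_matrix_conj_transpose U V)
  ultimately show ?thesis
    using A by (simp add: norm_minus_commute[of _ X] norm_diff_le_iff_inner
        inner_isometry_mult[OF S] inner_unitary_matrix)
qed

text \<open>The residual \<open>Y - X ** B\<close> is orthogonal to every
  \<open>X ** (B - C)\<close>, so Pythagoras applies.\<close>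

lemma normal_equations_minimize:
  fixes X :: "complex^'d^'m" and Y :: "complex^'k^'m"
  assumes "conj_transpose X ** X ** B = conj_transpose X ** Y"
  shows "norm (Y - X ** B) \<le> norm (Y - X ** C)"
proof -
  have orth: "conj_transpose X ** (Y - X ** B) = 0"
    using assms by (simp add: matrix_mult_diff_right matrix_mul_assoc)
  have split: "Y - X ** C = (Y - X ** B) + X ** (B - C)"
    by (simp add: matrix_mult_diff_right)
  have "(X ** (B - C)) \<bullet> (Y - X ** B) = 0"
    by (simp add: inner_matrix_mult_left orth)
  then show ?thesis
    unfolding split norm_le by (simp add: inner_add inner_commute)
qed

section \<open>Optimal phases and optimal columns\<close>

lemma inner_cis_phase: "z \<bullet> cis (phase \<theta> z) = cmod z"
proof (cases "z = 0")
  case False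
  then have "z \<bullet> cis (Arg z) = (cmod z *\<^sub>R cis (Arg z)) \<bullet> cis (Arg z)"
    using rcis_cmod_Arg[of z] by (simp add: rcis_def scaleR_conv_of_real)
  also have "\<dots> = cmod z"
    by (simp add: dot_square_norm)
  finally show ?thesis
    using False by (simp add: phase_def)
\<comment> \<open>At \<open>z = 0\<close> both sides vanish, whatever the value of
  \<open>\<theta>\<close>.\<close>
qed simp

text \<open>Cauchy-Schwarz bounds the left side by \<open>r * cmod z\<close>, and the aligned phase
  attains this bound.\<close>

lemma inner_le_inner_cis_phase:
  assumes "cmod w = r"
  shows "z \<bullet> w \<le> z \<bullet> (of_real r * cis (phase \<theta> z))"
proof -
  have "z \<bullet> w \<le> r * cmod z"
    using norm_cauchy_schwarz[of z w] assms by (simp add: mult.commute)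
  also have "\<dots> = z \<bullet> (r *\<^sub>R cis (phase \<theta> z))"
    by (simp add: inner_cis_phase)
  finally show ?thesis
    by (simp add: scaleR_conv_of_real)
qed

lemma nearest_of_modulus:
  assumes "cmod w = r"
  shows "norm (z - of_real r * cis (phase \<theta> z)) \<le> norm (z - w)"
proof -
  have "cmod (of_real r * cis (phase \<theta> z)) = cmod w"
    using assms by (auto simp: norm_mult)
  then show ?thesis
    using inner_le_inner_cis_phase[OF assms]
    by (subst norm_diff_le_iff_inner) (auto simp: dot_square_norm)
qed

text \<open>The Frobenius norm is monotone in the entry moduli, so the problem splits into one
  nearest-point problem on a circle per entry.\<close>

lemma exp_phase_minimizes:
  fixes X Y :: "complex^'d^'m"
  assumes "\<And>i k. cmod (X $ i $ k) = r"
  shows "norm (Y - r *\<^sub>R exp_phase \<theta> Y) \<le> norm (Y - X)"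
  using nearest_of_modulus[OF assms]
  by (auto intro!: norm_le_componentwise_cart simp: exp_phase_def scaleR_conv_of_real[where 'a=complex])

text \<open>The dependence on \<open>c\<close> passes through a single complex number, the Hermitian
  product of \<open>u\<close> and \<open>b\<close>; its phase is the angle used in the fixed
  subarray.\<close>

lemma inner_vector_smult:
  fixes u b :: "complex^'n"
  shows "u \<bullet> (c *s b) = (\<Sum>l\<in>UNIV. u $ l * cnj (b $ l)) \<bullet> c"
  by (simp add: inner_vec_def inner_sum_left) (simp add: inner_complex_def algebra_simps)

lemma norm_vector_smult_complex:
  fixes b :: "complex^'n"
  shows "norm (c *s b) = cmod c * norm b"
  by (simp add: norm_vec_def L2_set_def norm_mult power_mult_distrib
      real_sqrt_mult flip: sum_distrib_left)

text \<open>One row of the fixed-subarray problem: multiples of \<open>b\<close> by scalars of equal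
  modulus have equal norm, so only the inner product with \<open>u\<close> matters.\<close>

lemma phase_smult_minimizes:
  fixes u b :: "complex^'n"
  assumes "cmod c = r"
  shows "norm (u - (of_real r * cis (phase \<theta> (\<Sum>l\<in>UNIV. u $ l * cnj (b $ l)))) *s b)
    \<le> norm (u - c *s b)"
proof (subst norm_diff_le_iff_inner)
  let ?w = "of_real r * cis (phase \<theta> (\<Sum>l\<in>UNIV. u $ l * cnj (b $ l)))"
  have "cmod ?w = cmod c"
    using assms by (auto simp: norm_mult)
  then show "(?w *s b) \<bullet> (?w *s b) = (c *s b) \<bullet> (c *s b)"
    by (simp add: dot_square_norm norm_vector_smult_complex)
  show "u \<bullet> (c *s b) \<le> u \<bullet> (?w *s b)"
    unfolding inner_vector_smult by (rule inner_le_inner_cis_phase[OF assms])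
qed

text \<open>One row of the dynamic problem, optimal in column and phase together: all candidates
  have norm 1, and the inner product with \<open>y\<close> is at most the largest entry modulus,
  which the chosen vector attains.\<close>

lemma unit_axis_minimizes:
  fixes y :: "complex^'n"
  assumes "\<And>l. cmod (y $ l) \<le> cmod (y $ j)" and w: "cmod w = 1"
  shows "norm (y - axis j (cis (phase \<theta> (y $ j)))) \<le> norm (y - axis k w)"
proof (subst norm_diff_le_iff_inner)
  have "w \<bullet> w = 1"
    using w by (simp add: dot_square_norm)
  moreover have "cis t \<bullet> cis t = 1" for t
    by (simp add: dot_square_norm)
  ultimately show "axis j (cis (phase \<theta> (y $ j))) \<bullet> axis j (cis (phase \<theta> (y $ j))) =
      axis k w \<bullet> axis k w"
    by (simp only: inner_axis_axis simp_thms if_True)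
  have "y $ k \<bullet> w \<le> cmod (y $ j)"
    using norm_cauchy_schwarz[of "y $ k" w] w assms(1)[of k] by simp
  then show "y \<bullet> axis k w \<le> y \<bullet> axis j (cis (phase \<theta> (y $ j)))"
    by (simp add: inner_axis inner_cis_phase)
qed

section \<open>From descent at each iteration to convergence\<close>

lemma decseq_norm_converges:
  fixes f :: "nat \<Rightarrow> 'a::real_normed_vector"
  assumes "\<And>n. norm (f (Suc n)) \<le> norm (f n)"
  shows "decseq (\<lambda>n. norm (f n)) \<and> bdd_below (range (\<lambda>n. norm (f n))) \<and>
    convergent (\<lambda>n. norm (f n))"
proof (intro conjI)
  show dec: "decseq (\<lambda>n. norm (f n))"
    using assms by (rule decseq_SucI)
  show "bdd_below (range (\<lambda>n. norm (f n)))"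
    by (rule bdd_belowI[of _ 0]) auto
  show "convergent (\<lambda>n. norm (f n))"
    using decseq_convergent[OF dec, of 0] convergentI by (metis norm_ge_zero)
qed

section \<open>Descent for the fully connected array\<close>

lemma full_cost_Suc_le:
  fixes S :: "complex^'d^'m"
  assumes S: "conj_transpose S ** S = mat 1" and run: "full_run \<theta> S Sc Scm"
  shows "full_cost S Sc Scm (Suc n) \<le> full_cost S Sc Scm n"
proof -
  let ?r = "1 / sqrt (real CARD('m))"
  have step: "Sc (Suc n) = ?r *\<^sub>R exp_phase \<theta> (S ** conj_transpose (Scm n))" for n
    using run by (simp add: full_run_def)
  have svd: "\<exists>U \<Sigma> V. is_svd (conj_transpose S ** Sc n) U \<Sigma> V \<and> Scm n = V ** conj_transpose U" for n
    using run by (simp add: full_run_def)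
  have modulus: "cmod (Sc (Suc n) $ i $ k) = ?r" for i k
    by (simp add: step exp_phase_def)
  have unitary: "unitary_matrix (conj_transpose (Scm n))"
    using svd[of n] by (auto simp: is_svd_def intro!: unitary_matrix_mult unitary_matrix_conj_transpose)
  obtain U \<Sigma> V where "is_svd (conj_transpose S ** Sc (Suc n)) U \<Sigma> V"
    and "Scm (Suc n) = V ** conj_transpose U"
    using svd by blast
  \<comment> \<open>Procrustes half-step: \<open>conj_transpose (Scm (Suc n))\<close> equals
    \<open>U ** conj_transpose V\<close>, and its predecessor is a unitary competitor.\<close>
  then have "norm (S ** conj_transpose (Scm (Suc n)) - Sc (Suc n))
      \<le> norm (S ** conj_transpose (Scm n) - Sc (Suc n))"
    using orthogonal_procrustes[OF S _ unitary] by (simp add: conj_transpose_matrix_mult)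
  \<comment> \<open>Phase half-step: by \<open>modulus\<close>, \<open>Sc (Suc n)\<close> is a
    competitor of the new iterate.\<close>
  moreover have "norm (S ** conj_transpose (Scm (Suc n)) - Sc (Suc (Suc n)))
      \<le> norm (S ** conj_transpose (Scm (Suc n)) - Sc (Suc n))"
    unfolding step[of "Suc n"] by (rule exp_phase_minimizes[OF modulus])
  ultimately show ?thesis
    by (simp add: full_cost_def)
qed

section \<open>Descent for the fixed subarray\<close>

lemma conn_col_iff:
  assumes "connection_matrix P"
  shows "P $ i $ k \<noteq> 0 \<longleftrightarrow> k = conn_col P i"
proof -
  have "\<exists>!k. P $ i $ k \<noteq> 0"
    using assms by (simp add: connection_matrix_def)
  from theI'[OF this] this show ?thesis
    unfolding conn_col_def by blast
qed

lemma surj_conn_col: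
  assumes "connection_matrix P"
  shows "surj (conn_col P)"
  using assms conn_col_iff[OF assms] unfolding connection_matrix_def surj_def by metis

text \<open>Distinct columns have disjoint supports, so the Gram matrix is diagonal; surjectivity of
  \<open>j\<close> makes every column non-zero.\<close>

lemma invertible_gram_single_nonzero:
  fixes X :: "complex^'d^'m"
  assumes nz: "\<And>i k. X $ i $ k \<noteq> 0 \<longleftrightarrow> k = j i" and "surj j"
  shows "invertible (conj_transpose X ** X)"
proof -
  \<comment> \<open>\<open>g k\<close> is the squared norm of column \<open>k\<close>,
    \<open>G\<close> the Gram matrix and \<open>H\<close> its inverse.\<close>
  define g where "g k = (\<Sum>i\<in>UNIV. (cmod (X $ i $ k))\<^sup>2)" for k
  define G :: "complex^'d^'d" where "G = (\<chi> k l. if k = l then of_real (g k) else 0)"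
  define H :: "complex^'d^'d" where "H = (\<chi> k l. if k = l then of_real (1 / g k) else 0)"
  have "g k \<noteq> 0" for k
  proof -
    obtain i where "k = j i"
      using \<open>surj j\<close> by (rule surjE)
    then have "X $ i $ k \<noteq> 0"
      by (simp add: nz)
    then show ?thesis
      by (auto simp: g_def sum_nonneg_eq_0_iff)
  qed
  then have "G ** H = mat 1" "H ** G = mat 1"
    by (simp_all add: vec_eq_iff matrix_mult_nth G_def H_def mat_def if_distrib[of "\<lambda>x. x * _"]
        cong: if_cong flip: of_real_mult)
  then have "invertible G"
    unfolding invertible_def by blast
  moreover have "conj_transpose X ** X = G"
  proof -
    have "(conj_transpose X ** X) $ k $ l = G $ k $ l" for k l
    proof (cases "k = l")
      case True
      then show ?thesis
        by (simp add: matrix_mult_nth G_def g_def complex_norm_square mult.commute del: of_real_power)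
    next
      case False
      then have "cnj (X $ i $ k) * X $ i $ l = 0" for i
        using nz[of i k] nz[of i l] by auto
      with False show ?thesis
        by (simp only: matrix_mult_nth G_def conj_transpose_nth vec_lambda_beta sum.neutral_const if_False)
    qed
    then show ?thesis
      by (simp add: vec_eq_iff)
  qed
  ultimately show ?thesis
    by simp
qed

text \<open>Splits the fixed-subarray cost into independent row problems.\<close>

lemma matrix_mult_row_single:
  fixes X :: "complex^'d^'m"
  assumes "\<And>k. k \<noteq> j \<Longrightarrow> X $ i $ k = 0"
  shows "(X ** B) $ i = (X $ i $ j) *s (B $ j)"
proof -
  have "(\<Sum>l\<in>UNIV. X $ i $ l * B $ l $ k) = X $ i $ j * B $ j $ k" for k
    by (subst sum.remove[of _ j]) (auto simp: assms)
  then show ?thesis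
    by (simp add: vec_eq_iff matrix_mult_nth)
qed

lemma fixed_cost_Suc_le:
  fixes S :: "complex^'d^'m"
  assumes P: "connection_matrix P" and run: "fixed_run \<theta> S P Sc Scm"
  shows "fixed_cost S Sc Scm (Suc n) \<le> fixed_cost S Sc Scm n"
proof -
  let ?r = "1 / sqrt (real CARD('m))"
  let ?X = "Sc (Suc n)"
  have step: "Sc (Suc n) $ i $ k = (if k = conn_col P i
      then of_real ?r * cis (phase \<theta> (\<Sum>l\<in>UNIV. S $ i $ l * cnj (Scm n $ conn_col P i $ l)))
      else 0)" for n i k
    using run by (simp add: fixed_run_def)
  have Scm: "Scm n = matrix_inv (conj_transpose (Sc n) ** Sc n) ** conj_transpose (Sc n) ** S" for n
    using run by (simp add: fixed_run_def)
  have modulus: "cmod (?X $ i $ conn_col P i) = ?r" for i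
    unfolding step by (simp add: norm_mult del: of_real_divide)
  \<comment> \<open>This makes \<open>matrix_inv\<close> a genuine inverse, so that
    \<open>Scm (Suc n)\<close> solves the normal equations.\<close>
  have "invertible (conj_transpose ?X ** ?X)"
    by (rule invertible_gram_single_nonzero[OF _ surj_conn_col[OF P]]) (simp add: step)
  then have "conj_transpose ?X ** ?X ** Scm (Suc n) = conj_transpose ?X ** S"
    unfolding Scm[of "Suc n"] by (simp add: matrix_mul_assoc matrix_mult_matrix_inv)
  then have "norm (S - ?X ** Scm (Suc n)) \<le> norm (S - ?X ** Scm n)"
    by (rule normal_equations_minimize)
  moreover have "norm (S - Sc (Suc (Suc n)) ** Scm (Suc n)) \<le> norm (S - ?X ** Scm (Suc n))"
  proof (rule norm_le_componentwise_cart)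
    fix i
    have row: "(Sc (Suc m) ** B) $ i = (Sc (Suc m) $ i $ conn_col P i) *s (B $ conn_col P i)"
      for m and B :: "complex^'d^'d"
      by (rule matrix_mult_row_single) (simp add: step)
    show "norm ((S - Sc (Suc (Suc n)) ** Scm (Suc n)) $ i) \<le> norm ((S - ?X ** Scm (Suc n)) $ i)"
      using phase_smult_minimizes[OF modulus[of i], of "S $ i" \<theta> "Scm (Suc n) $ conn_col P i"]
      by (simp only: vector_minus_component row step[of "Suc n"] simp_thms if_True)
  qed
  ultimately show ?thesis
    by (simp add: fixed_cost_def)
qed

section \<open>Descent for the dynamic connection\<close>

lemma dynamic_cost_Suc_le:
  fixes S :: "complex^'d^'m"
  assumes S: "conj_transpose S ** S = mat 1" and run: "dynamic_run \<theta> S St A"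
  shows "dynamic_cost S St A (Suc n) \<le> dynamic_cost S St A n"
proof -
  have svd: "\<exists>U \<Sigma> V. is_svd (conj_transpose S ** St n) U \<Sigma> V \<and> A n = U ** conj_transpose V" for n
    using run by (simp add: dynamic_run_def)
  have step: "\<exists>js. \<forall>i. (\<forall>l. cmod ((S ** A n) $ i $ l) \<le> cmod ((S ** A n) $ i $ js i)) \<and>
      St (Suc n) $ i = axis (js i) (cis (phase \<theta> ((S ** A n) $ i $ js i)))" for n
  proof -
    obtain js where "\<forall>i. is_arg_max (\<lambda>k. cmod ((S ** A n) $ i $ k)) (\<lambda>_. True) (js i)"
      and "St (Suc n) = (\<chi> i k. if k = js i then cis (phase \<theta> ((S ** A n) $ i $ js i)) else 0)"
      using run unfolding dynamic_run_def by blast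
    then show ?thesis
      by (intro exI[of _ js]) (auto simp: is_arg_max_linorder axis_def vec_eq_iff)
  qed
  have unitary: "unitary_matrix (A n)"
    using svd[of n] by (auto simp: is_svd_def intro!: unitary_matrix_mult unitary_matrix_conj_transpose)
  obtain U \<Sigma> V where "is_svd (conj_transpose S ** St (Suc n)) U \<Sigma> V"
    and "A (Suc n) = U ** conj_transpose V"
    using svd by blast
  then have "norm (S ** A (Suc n) - St (Suc n)) \<le> norm (S ** A n - St (Suc n))"
    using orthogonal_procrustes[OF S _ unitary] by simp
  moreover have "norm (S ** A (Suc n) - St (Suc (Suc n))) \<le> norm (S ** A (Suc n) - St (Suc n))"
  proof (rule norm_le_componentwise_cart)
    fix i
    \<comment> \<open>The old row is an axis vector with a unit-modulus entry, hence a competitor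
      even if its column differs from the new one.\<close>
    obtain k w where "cmod w = 1" "St (Suc n) $ i = axis k w"
      using step[of n] by (metis norm_cis)
    then show "norm ((S ** A (Suc n) - St (Suc (Suc n))) $ i)
        \<le> norm ((S ** A (Suc n) - St (Suc n)) $ i)"
      using step[of "Suc n"] by (auto intro!: unit_axis_minimizes)
  qed
  ultimately show ?thesis
    by (simp add: dynamic_cost_def)
qed

theorem mainTheorem2:
  fixes S_GEB :: "complex^'d^'m" and \<theta> :: real
  assumes "CARD('d) \<le> CARD('m)"
    and "conj_transpose S_GEB ** S_GEB = mat 1"
  shows "(\<forall>Sc Scm. full_run \<theta> S_GEB Sc Scm \<longrightarrow>
            decseq (full_cost S_GEB Sc Scm) \<and>
            bdd_below (range (full_cost S_GEB Sc Scm)) \<and>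
            convergent (full_cost S_GEB Sc Scm)) \<and>
         (\<forall>P Sc Scm. connection_matrix P \<longrightarrow> fixed_run \<theta> S_GEB P Sc Scm \<longrightarrow>
            decseq (fixed_cost S_GEB Sc Scm) \<and>
            bdd_below (range (fixed_cost S_GEB Sc Scm)) \<and>
            convergent (fixed_cost S_GEB Sc Scm)) \<and>
         (\<forall>St A. dynamic_run \<theta> S_GEB St A \<longrightarrow>
            decseq (dynamic_cost S_GEB St A) \<and>
            bdd_below (range (dynamic_cost S_GEB St A)) \<and>
            convergent (dynamic_cost S_GEB St A))"
proof (intro conjI allI impI)
  fix Sc Scm
  assume "full_run \<theta> S_GEB Sc Scm"
  \<comment> \<open>Applied to the residual matrices; folding the definition turns their norms into
    the cost.\<close>
  note conv = decseq_norm_converges[of "\<lambda>n. S_GEB ** conj_transpose (Scm n) - Sc (Suc n)",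
      folded full_cost_def, OF full_cost_Suc_le[OF assms(2) this]]
  show "decseq (full_cost S_GEB Sc Scm)" "bdd_below (range (full_cost S_GEB Sc Scm))"
    "convergent (full_cost S_GEB Sc Scm)"
    using conv by simp_all
next
  fix P Sc Scm
  assume "connection_matrix P" "fixed_run \<theta> S_GEB P Sc Scm"
  note conv = decseq_norm_converges[of "\<lambda>n. S_GEB - Sc (Suc n) ** Scm n",
      folded fixed_cost_def, OF fixed_cost_Suc_le[OF this]]
  show "decseq (fixed_cost S_GEB Sc Scm)" "bdd_below (range (fixed_cost S_GEB Sc Scm))"
    "convergent (fixed_cost S_GEB Sc Scm)"
    using conv by simp_all
next
  fix St A
  assume "dynamic_run \<theta> S_GEB St A"
  note conv = decseq_norm_converges[of "\<lambda>n. S_GEB ** A n - St (Suc n)",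
      folded dynamic_cost_def, OF dynamic_cost_Suc_le[OF assms(2) this]]
  show "decseq (dynamic_cost S_GEB St A)" "bdd_below (range (dynamic_cost S_GEB St A))"
    "convergent (dynamic_cost S_GEB St A)"
    using conv by simp_all
qed

end
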